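(* Let $(A,\omega)$ be a commutative baric $K$-algebra satisfying $2x^{2}x^{4}=\omega(x)^{2}x^{4}+\omega(x)^{4}x^{2}$ for all $x\in A$, with Peirce decomposition $A=Ke\oplus A_0\oplus A_{\frac12}\oplus A_{\lambda}\oplus A_{\bar\lambda}$ relative to a non-zero idempotent $e$. The following assertions are equivalent: (i) $A$ is a Jordan algebra; (ii) $A$ is a power associative algebra; (iii) $A_\lambda=A_{\bar\lambda}=0$, $A_0^2=0$, and $x_0(x_0x_{\frac12})=0$ for all $x_0\in A_0$ and $x_{\frac12}\in A_{\frac12}$; (iv) $A$ is a principal train algebra of rank $3$ satisfying the equation $x^3-\omega(x)x^2=0$.
   Context: $K$ is an algebraically closed (infinite, commutative) field of characteristic different from $2$. Algebras are commutative but not necessarily associative. A baric $K$-algebra $(A,\omega)$ is a $K$-algebra $A$ with a non-zero algebra homomorphism $\omega:A\to K$. Principal powers are $x^1=x$, $x^{k+1}=x\,x^{k}$. $A$ is power associative if every subalgebra generated by one element is associative, i.e. $x^ix^j=x^{i+j}$ for all $x\in A$, $i,j\ge1$. $A$ is a Jordan algebra if $x^2(yx)=(x^2y)x$ for all $x,y\in A$. $(A,\omega)$ is a principal train algebra of rank $n\ge 2$ if there are $\gamma_1,\dots,\gamma_{n-1}\in K$ with $x^n+\gamma_1\omega(x)x^{n-1}+\dots+\gamma_{n-1}\omega(x)^{n-1}x=0$ for all $x\in A$, where $n\ge2$ is the smallest integer with this property. Here $\lambda=\frac{-1-i\sqrt{23}}{4}$, $\bar\lambda=\frac{-1+i\sqrt{23}}{4}$,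 where $i\sqrt{23}$ denotes a fixed square root of $-23$ in $K$, and for an idempotent $e$, $A_\alpha=\{x\in\ker\omega: ex=\alpha x\}$ for $\alpha\in\{0,\frac12,\lambda,\bar\lambda\}$.
   Formalization: Characteristic 3 is excluded (there λ, λ̄ are 0, 1 and the claim fails for Ke+Kv, ev=v, v²=0); in (iv) the rank is 2 or 3, and exactly 3 when A is not of rank 2 (A=K satisfies (i)–(iii) but has rank 2). *)

theory Defs
  imports "HOL-Computational_Algebra.Computational_Algebra"
begin

text \<open>The underlying vector space of an algebra is a whole type with an explicit scalar
  multiplication; the product is an explicit bilinear map, not assumed associative or unital.\<close>

locale comm_algebra = vector_space scale
  for scale :: "'k::field \<Rightarrow> 'a::ab_group_add \<Rightarrow> 'a" +
  fixes mul :: "'a \<Rightarrow> 'a \<Rightarrow> 'a"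
  assumes mult_commute: "mul x y = mul y x"
    and mult_linear: "Vector_Spaces.linear scale scale (mul x)"

locale baric_algebra = comm_algebra scale mul
  for scale :: "'k::field \<Rightarrow> 'a::ab_group_add \<Rightarrow> 'a" and mul :: "'a \<Rightarrow> 'a \<Rightarrow> 'a" +
  fixes \<omega> :: "'a \<Rightarrow> 'k"
  assumes weight_linear: "Vector_Spaces.linear scale (*) \<omega>"
    and weight_mult: "\<omega> (mul x y) = \<omega> x * \<omega> y"
    and weight_nonzero: "\<exists>x. \<omega> x \<noteq> 0"

text \<open>Principal powers; there is no unit, so the exponent \<open>0\<close> is left unspecified.\<close>

fun ppow :: "('a \<Rightarrow> 'a \<Rightarrow> 'a) \<Rightarrow> 'a \<Rightarrow> nat \<Rightarrow> 'a" where
  "ppow mul x 0 = undefined"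
| "ppow mul x (Suc 0) = x"
| "ppow mul x (Suc (Suc k)) = mul x (ppow mul x (Suc k))"

definition subalgebra :: "('k::field \<Rightarrow> 'a::ab_group_add \<Rightarrow> 'a) \<Rightarrow> ('a \<Rightarrow> 'a \<Rightarrow> 'a) \<Rightarrow> 'a set \<Rightarrow> bool" where
  "subalgebra scale mul S \<longleftrightarrow>
     module.subspace scale S \<and> (\<forall>x\<in>S. \<forall>y\<in>S. mul x y \<in> S)"

definition power_associative :: "('k::field \<Rightarrow> 'a::ab_group_add \<Rightarrow> 'a) \<Rightarrow> ('a \<Rightarrow> 'a \<Rightarrow> 'a) \<Rightarrow> bool" where
  "power_associative scale mul \<longleftrightarrow>
     (\<forall>x. \<forall>u \<in> subalgebra scale mul hull {x}. \<forall>v \<in> subalgebra scale mul hull {x}.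
        \<forall>w \<in> subalgebra scale mul hull {x}. mul (mul u v) w = mul u (mul v w))"

text \<open>To be used for commutative products only.\<close>

definition jordan :: "('a \<Rightarrow> 'a \<Rightarrow> 'a) \<Rightarrow> bool" where
  "jordan mul \<longleftrightarrow>
     (\<forall>x y. mul (ppow mul x 2) (mul y x) = mul (mul (ppow mul x 2) y) x)"

definition train_equation ::
  "('k::field \<Rightarrow> 'a::ab_group_add \<Rightarrow> 'a) \<Rightarrow> ('a \<Rightarrow> 'a \<Rightarrow> 'a) \<Rightarrow> ('a \<Rightarrow> 'k) \<Rightarrow> nat \<Rightarrow> (nat \<Rightarrow> 'k) \<Rightarrow> bool" where
  "train_equation scale mul \<omega> n \<gamma> \<longleftrightarrow>
     (\<forall>x. ppow mul x n + (\<Sum>k = 1..n - 1. scale (\<gamma> k * \<omega> x ^ k) (ppow mul x (n - k))) = 0)"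

definition principal_train_of_rank ::
  "('k::field \<Rightarrow> 'a::ab_group_add \<Rightarrow> 'a) \<Rightarrow> ('a \<Rightarrow> 'a \<Rightarrow> 'a) \<Rightarrow> ('a \<Rightarrow> 'k) \<Rightarrow> nat \<Rightarrow> bool" where
  "principal_train_of_rank scale mul \<omega> n \<longleftrightarrow>
     2 \<le> n \<and> (\<exists>\<gamma>. train_equation scale mul \<omega> n \<gamma>) \<and>
     (\<forall>m. 2 \<le> m \<and> m < n \<longrightarrow> \<not> (\<exists>\<gamma>. train_equation scale mul \<omega> m \<gamma>))"

definition peirce ::
  "('k::field \<Rightarrow> 'a::ab_group_add \<Rightarrow> 'a) \<Rightarrow> ('a \<Rightarrow> 'a \<Rightarrow> 'a) \<Rightarrow> ('a \<Rightarrow> 'k) \<Rightarrow> 'a \<Rightarrow> 'k \<Rightarrow> 'a set" where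
  "peirce scale mul \<omega> e \<alpha> = {x. \<omega> x = 0 \<and> mul e x = scale \<alpha> x}"

text \<open>The whole space is the internal direct sum of the listed subspaces. The summands are indexed
  by position, so a subspace that is listed twice has to be zero.\<close>

definition direct_sum_decomposition :: "'a::ab_group_add set list \<Rightarrow> bool" where
  "direct_sum_decomposition Vs \<longleftrightarrow> (\<forall>x. \<exists>!xs. xs \<in> listset Vs \<and> x = sum_list xs)"

end

theory Submission
  imports Defs
begin

text \<open>
  Both the Jordan identity (put \<open>y = x\<close>) and power associativity contain the quartic identity
  \<open>x\<^sup>2 x\<^sup>2 = x\<^sup>4\<close>. The proof is therefore a circle: the quartic identity implies (iii), (iii) implies
  \<open>x\<^sup>3 = \<omega>(x) x\<^sup>2\<close>, and this cubic identity implies that the algebra is Jordan and power associative.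
  A train equation of rank 3 with the right coefficients is exactly the cubic identity; the rank
  drops to 2 when the algebra already satisfies an equation of degree 2.

  The first two arrows are read off from the identities on the lines \<open>e + t y\<close> with \<open>\<omega>(y) = 0\<close>.
  The field is infinite, so coefficients of equal powers of \<open>t\<close> agree
  (\<open>vec_poly_eq_imp_nth_eq\<close>), and every coefficient is an equation between products of \<open>e\<close> and
  \<open>y\<close>, in which \<open>L = (z \<mapsto> e z)\<close> acts by scalars on the Peirce components. Write \<open>u\<close> for elements of
  \<open>A\<^sub>0\<close> and \<open>v\<close> for elements of \<open>A\<close> at eigenvalue \<open>1/2\<close>.

  Quartic identity to (iii): the coefficient of \<open>t\<close> is \<open>L (2L - 1) (L - 1) y = 0\<close>. The numbers
  \<open>\<lambda>\<close> and its conjugate are the roots of \<open>2 X\<^sup>2 + X + 3\<close> and differ from 0, 1/2 and 1 in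
  characteristic other than 2 and 3, so their eigenspaces vanish. The coefficient of \<open>t\<^sup>2\<close> at \<open>y = u\<close>,
  together with the same coefficient of the identity of degree 6, yields \<open>u\<^sup>2 = 0\<close>
  (\<open>quartic_imp_square_zero\<close>), and the part of the coefficient of \<open>t\<^sup>3\<close> that is odd in \<open>v\<close>
  yields \<open>u (u v) = 0\<close> (\<open>quartic_imp_annihilation\<close>).

  (iii) to the cubic identity: the identity of degree 6 forces \<open>v\<^sup>2 \<in> A\<^sub>0\<close> and keeps \<open>u v\<close> in the
  eigenspace of 1/2 (\<open>square_half\<close>, \<open>mul_zero_half\<close>). Hence for \<open>x = \<omega>(x) e + y\<close> and \<open>y = u + v\<close> the
  difference \<open>x\<^sup>3 - \<omega>(x) x\<^sup>2\<close> is \<open>w = y y\<^sup>2\<close>. The coefficient of \<open>t\<^sup>3\<close> in the identity of degree 6 is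
  \<open>(2 L\<^sup>2 + L + 3) w = 0\<close>, and this operator is invertible on the kernel of \<open>\<omega>\<close>, where \<open>L\<close> only has
  the eigenvalues 0 and 1/2; so \<open>w = 0\<close> (\<open>kernel_cube_zero\<close>).

  Cubic identity to the Jordan identity: linearised, it expresses the multiplication by \<open>x\<^sup>2\<close> through
  the multiplication by \<open>x\<close>, up to a multiple of \<open>x\<^sup>2\<close> which is harmless because \<open>x\<^sup>3\<close> is a multiple
  of \<open>x\<^sup>2\<close>; so the two multiplications commute (\<open>cubic_imp_jordan\<close>).
\<close>

section \<open>Polynomials with coefficients in an algebra\<close>

text \<open>Over a finite field the product of all \<open>X - a\<close>, increased by 1, has no root.\<close>

lemma alg_closed_field_infinite: "infinite (UNIV :: 'k::alg_closed_field set)"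
proof
  assume fin: "finite (UNIV :: 'k set)"
  define q :: "'k poly" where "q = (\<Prod>a\<in>UNIV. [:- a, 1:])"
  have deg: "degree q = card (UNIV :: 'k set)"
    unfolding q_def using fin by (subst degree_prod_eq_sum_degree) auto
  have pos: "card (UNIV :: 'k set) > 0"
    using fin by (simp add: card_gt_0_iff)
  have "degree (q + 1) = card (UNIV :: 'k set)"
    using deg pos by (subst degree_add_eq_left) auto
  then obtain z where "poly (q + 1) z = 0"
    using alg_closed_imp_poly_has_root[of "q + 1"] pos by auto
  moreover have "poly q z = 0"
    unfolding q_def poly_prod using fin by (intro prod_zero) auto
  ultimately show False by simp
qed

text \<open>Elements of \<open>A[t]\<close> are coefficient lists, constant term first and without normalisation. Lists
  keep the length of an explicit expansion visible, so that the simplifier multiplies out powers of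
  \<open>e + t y\<close> and the entry at a given degree can be selected by position.\<close>

fun coeffs_add :: "'a::ab_group_add list \<Rightarrow> 'a list \<Rightarrow> 'a list" where
  "coeffs_add [] ds = ds"
| "coeffs_add cs [] = cs"
| "coeffs_add (c # cs) (d # ds) = (c + d) # coeffs_add cs ds"

primrec coeffs_mult :: "('a::ab_group_add \<Rightarrow> 'a \<Rightarrow> 'a) \<Rightarrow> 'a list \<Rightarrow> 'a list \<Rightarrow> 'a list" where
  "coeffs_mult f [] ds = []"
| "coeffs_mult f (c # cs) ds = coeffs_add (map (f c) ds) (0 # coeffs_mult f cs ds)"

context comm_algebra
begin

notation scale (infixr "*s" 75)
notation mul (infixl "\<bullet>" 70)

lemma mul_add_right: "x \<bullet> (y + z) = x \<bullet> y + x \<bullet> z"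
  and mul_scale_right: "x \<bullet> (c *s y) = c *s (x \<bullet> y)"
  using mult_linear[of x] by (simp_all add: Vector_Spaces.linear_iff)

lemma mul_add_left: "(y + z) \<bullet> x = y \<bullet> x + z \<bullet> x"
  and mul_scale_left: "(c *s y) \<bullet> x = c *s (y \<bullet> x)"
  using mul_add_right mul_scale_right by (simp_all add: mult_commute[of _ x])

lemma mul_zero_right [simp]: "x \<bullet> 0 = 0"
  using mul_scale_right[of x 0 0] by simp

lemma mul_zero_left [simp]: "0 \<bullet> x = 0"
  by (simp add: mult_commute[of _ x])

lemma mul_minus_right [simp]: "x \<bullet> (- y) = - (x \<bullet> y)"
  by (rule minus_unique[symmetric]) (simp flip: mul_add_right)

lemma mul_minus_left [simp]: "(- y) \<bullet> x = - (y \<bullet> x)"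
  by (simp add: mult_commute[of _ x])

lemma mul_diff_right: "x \<bullet> (y - z) = x \<bullet> y - x \<bullet> z"
  using mul_add_right[of x y "- z"] by simp

lemma mul_diff_left: "(y - z) \<bullet> x = y \<bullet> x - z \<bullet> x"
  using mul_add_left[of y "- z"] by simp

lemmas mul_distribs = mul_add_right mul_add_left mul_diff_right mul_diff_left
  mul_scale_right mul_scale_left

definition vec_poly :: "'k \<Rightarrow> 'a list \<Rightarrow> 'a" where
  "vec_poly t cs = foldr (\<lambda>c s. c + t *s s) cs 0"

lemma vec_poly_simps [simp]:
  fixes t :: 'k and c :: 'a
  shows "vec_poly t [] = 0"
    and "vec_poly t (c # cs) = c + t *s vec_poly t cs"
  by (simp_all add: vec_poly_def)

text \<open>In coordinates with respect to a basis both sides become ordinary polynomials that agree at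
  infinitely many points.\<close>

lemma vec_poly_eq_imp_nth_eq:
  assumes inf: "infinite (UNIV :: 'k set)"
    and eq: "\<And>t. vec_poly t cs = vec_poly t ds"
    and i: "i < length cs" "i < length ds"
  shows "cs ! i = ds ! i"
proof -
  define B where "B = extend_basis {}"
  have indep: "independent B" and span: "span B = UNIV"
    unfolding B_def by (simp_all add: independent_extend_basis independent_empty span_extend_basis)
  have coord: "representation B (cs ! i) b = representation B (ds ! i) b" for b
  proof -
    define f where "f = (\<lambda>v. representation B v b)"
    have f_vec_poly: "poly (Poly (map f xs)) t = f (vec_poly t xs)" for xs t
      by (induction xs)
        (simp_all add: f_def representation_zero representation_add[OF indep]
          representation_scale[OF indep] span)
    have "{t. poly (Poly (map f cs) - Poly (map f ds)) t = 0} = UNIV"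
      by (simp add: f_vec_poly eq)
    then have "Poly (map f cs) - Poly (map f ds) = 0"
      using poly_roots_finite inf by metis
    then have "coeff (Poly (map f cs)) i = coeff (Poly (map f ds)) i" by simp
    with i show ?thesis by (simp add: nth_default_def f_def)
  qed
  have "cs ! i = (\<Sum>b | representation B (cs ! i) b \<noteq> 0. representation B (cs ! i) b *s b)"
    using sum_nonzero_representation_eq[OF indep] span by simp
  also have "\<dots> = ds ! i"
    unfolding coord using sum_nonzero_representation_eq[OF indep] span by simp
  finally show ?thesis .
qed

lemma scale_two: "2 *s x = x + x"
  by (metis one_add_one scale_left_distrib scale_one)

lemma vec_poly_coeffs_add: "vec_poly t (coeffs_add cs ds) = vec_poly t cs + vec_poly t ds"
  by (induction cs ds rule: coeffs_add.induct) (simp_all add: scale_right_distrib algebra_simps)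

lemma vec_poly_map_mul: "vec_poly t (map (mul c) ds) = c \<bullet> vec_poly t ds"
  by (induction ds) (simp_all add: mul_distribs)

lemma vec_poly_coeffs_mult: "vec_poly t (coeffs_mult mul cs ds) = vec_poly t cs \<bullet> vec_poly t ds"
  by (induction cs)
    (simp_all add: vec_poly_coeffs_add vec_poly_map_mul mul_distribs)

end

section \<open>Consequences of the cubic identity\<close>

context baric_algebra
begin

lemma weight_add [simp]: "\<omega> (x + y) = \<omega> x + \<omega> y"
  and weight_scale [simp]: "\<omega> (c *s x) = c * \<omega> x"
  using weight_linear by (simp_all add: Vector_Spaces.linear_iff)

lemma weight_zero [simp]: "\<omega> 0 = 0"
  using weight_scale[of 0 0] by simp

lemma weight_minus [simp]: "\<omega> (- x) = - \<omega> x"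
  by (rule minus_unique[symmetric]) (simp flip: weight_add)

lemma weight_diff [simp]: "\<omega> (x - y) = \<omega> x - \<omega> y"
  using weight_add[of x "- y"] by simp

declare weight_mult [simp]

text \<open>The part of the cubic identity of degree 2 in \<open>x\<close> and 1 in \<open>y\<close>. Subtracting the identities at
  \<open>x + y\<close> and \<open>x - y\<close> leaves the part odd in \<open>y\<close>, and the identity at \<open>y\<close> removes its cubic term.\<close>

lemma cubic_linearised:
  assumes two: "(2::'k) \<noteq> 0" and cubic: "\<And>x. x \<bullet> (x \<bullet> x) = \<omega> x *s (x \<bullet> x)"
  shows "x \<bullet> (x \<bullet> y) + x \<bullet> (x \<bullet> y) + (x \<bullet> x) \<bullet> y =
    \<omega> x *s (x \<bullet> y) + \<omega> x *s (x \<bullet> y) + \<omega> y *s (x \<bullet> x)"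
proof -
  let ?d = "x \<bullet> (x \<bullet> y) + x \<bullet> (x \<bullet> y) + (x \<bullet> x) \<bullet> y -
    (\<omega> x *s (x \<bullet> y) + \<omega> x *s (x \<bullet> y) + \<omega> y *s (x \<bullet> x))"
  let ?F = "\<lambda>z. z \<bullet> (z \<bullet> z) - \<omega> z *s (z \<bullet> z)"
  have "?d + ?d = ?F (x + y) - ?F (x - y) - (?F y + ?F y)"
    by (simp add: mul_distribs scale_left_distrib scale_right_distrib
        scale_left_diff_distrib scale_right_diff_distrib mult_commute[of y x]
        mult_commute[of y "x \<bullet> x"] algebra_simps)
  also have "\<dots> = 0" by (simp add: cubic)
  finally have "?d + ?d = 0" .
  then have "?d = 0" using two by (simp flip: scale_two)
  then show ?thesis by simp
qed

text \<open>Two expressions for \<open>x (x (x y))\<close>: multiply the linearised identity by \<open>x\<close>, or replace \<open>y\<close> in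
  it by \<open>x y\<close>. Everything cancels except \<open>x (x\<^sup>2 y)\<close> and \<open>x\<^sup>2 (x y)\<close>.\<close>

lemma cubic_imp_jordan:
  assumes two: "(2::'k) \<noteq> 0" and cubic: "\<And>x. x \<bullet> (x \<bullet> x) = \<omega> x *s (x \<bullet> x)"
  shows "(x \<bullet> x) \<bullet> (y \<bullet> x) = ((x \<bullet> x) \<bullet> y) \<bullet> x"
proof -
  have "x \<bullet> (x \<bullet> (x \<bullet> y) + x \<bullet> (x \<bullet> y) + (x \<bullet> x) \<bullet> y) =
      x \<bullet> (\<omega> x *s (x \<bullet> y) + \<omega> x *s (x \<bullet> y) + \<omega> y *s (x \<bullet> x))"
    by (simp only: cubic_linearised[OF two cubic])
  moreover have "x \<bullet> (x \<bullet> (x \<bullet> y)) + x \<bullet> (x \<bullet> (x \<bullet> y)) + (x \<bullet> x) \<bullet> (x \<bullet> y) =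
      \<omega> x *s (x \<bullet> (x \<bullet> y)) + \<omega> x *s (x \<bullet> (x \<bullet> y)) + \<omega> (x \<bullet> y) *s (x \<bullet> x)"
    by (rule cubic_linearised[OF two cubic])
  ultimately have "x \<bullet> ((x \<bullet> x) \<bullet> y) = (x \<bullet> x) \<bullet> (x \<bullet> y)"
    by (simp add: mul_distribs cubic mult.commute) (metis add.commute add.left_commute add_left_cancel)
  then show ?thesis by (metis mult_commute)
qed

text \<open>The subalgebra generated by \<open>x\<close> is spanned by \<open>x\<close> and \<open>x\<^sup>2\<close>, and there the product of \<open>p\<close> and \<open>q\<close>
  is \<open>\<chi>(p) \<chi>(q) x\<^sup>2\<close> for the linear form \<open>\<chi>(a x + b x\<^sup>2) = a + b \<omega>(x)\<close>; both ways to bracket a triple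
  product then give the same multiple of \<open>x\<^sup>2\<close>.\<close>

lemma cubic_imp_power_associative:
  assumes two: "(2::'k) \<noteq> 0" and cubic: "\<And>x. x \<bullet> (x \<bullet> x) = \<omega> x *s (x \<bullet> x)"
  shows "power_associative scale mul"
proof -
  have assoc: "(u \<bullet> v) \<bullet> w = u \<bullet> (v \<bullet> w)"
    if "u \<in> subalgebra scale mul hull {x}" "v \<in> subalgebra scale mul hull {x}"
      "w \<in> subalgebra scale mul hull {x}" for x u v w
  proof -
    define S where "S = {a *s x + b *s (x \<bullet> x) |a b. True}"
    have sq: "(x \<bullet> x) \<bullet> (x \<bullet> x) = \<omega> x ^ 2 *s (x \<bullet> x)"
      using cubic_imp_jordan[OF two cubic, of x x]
      by (simp add: mult_commute[of "x \<bullet> x" x] cubic mul_distribs power2_eq_square)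
    have mul_S: "(a *s x + b *s (x \<bullet> x)) \<bullet> (c *s x + d *s (x \<bullet> x)) =
        ((a + b * \<omega> x) * (c + d * \<omega> x)) *s (x \<bullet> x)" for a b c d
      by (simp add: mul_distribs mult_commute[of "x \<bullet> x" x] cubic sq flip: scale_left_distrib)
        (simp add: algebra_simps power2_eq_square)
    have S_I: "a *s x + b *s (x \<bullet> x) \<in> S" for a b unfolding S_def by blast
    have S_I2: "b *s (x \<bullet> x) \<in> S" for b using S_I[of 0 b] by simp
    have "subalgebra scale mul S"
      unfolding subalgebra_def subspace_def
    proof (intro conjI ballI allI)
      show "0 \<in> S" using S_I2[of 0] by simp
    next
      fix p q assume "p \<in> S" "q \<in> S"
      then obtain a b c d where "p = a *s x + b *s (x \<bullet> x)" "q = c *s x + d *s (x \<bullet> x)"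
        unfolding S_def by blast
      then have "p + q = (a + c) *s x + (b + d) *s (x \<bullet> x)" "p \<bullet> q \<in> S"
        by (simp_all only: mul_S S_I2 scale_left_distrib add_ac)
      then show "p + q \<in> S" "p \<bullet> q \<in> S" by (simp_all add: S_I)
    next
      fix c p assume "p \<in> S"
      then obtain a b where "p = a *s x + b *s (x \<bullet> x)" unfolding S_def by blast
      then have "c *s p = (c * a) *s x + (c * b) *s (x \<bullet> x)"
        by (simp add: scale_right_distrib)
      then show "c *s p \<in> S" by (simp add: S_I)
    qed
    moreover have "x \<in> S" using S_I[of 1 0] by simp
    ultimately have "subalgebra scale mul hull {x} \<subseteq> S"
      by (intro hull_minimal) auto
    with that have "u \<in> S" "v \<in> S" "w \<in> S" by auto
    then obtain a b c d f g where eqs: "u = a *s x + b *s (x \<bullet> x)" "v = c *s x + d *s (x \<bullet> x)"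
        "w = f *s x + g *s (x \<bullet> x)"
      unfolding S_def by blast
    have "(k *s (x \<bullet> x)) \<bullet> (f *s x + g *s (x \<bullet> x)) = (k * \<omega> x * (f + g * \<omega> x)) *s (x \<bullet> x)"
      "(a *s x + b *s (x \<bullet> x)) \<bullet> (k *s (x \<bullet> x)) = ((a + b * \<omega> x) * (k * \<omega> x)) *s (x \<bullet> x)" for k
      using mul_S[of 0 k f g] mul_S[of a b 0 k] by simp_all
    then show ?thesis unfolding eqs mul_S by (simp add: mult_ac)
  qed
  then show ?thesis unfolding power_associative_def by blast
qed

lemma power_associative_imp_quartic:
  assumes "power_associative scale mul"
  shows "(x \<bullet> x) \<bullet> (x \<bullet> x) = x \<bullet> (x \<bullet> (x \<bullet> x))"
proof -
  have x: "x \<in> subalgebra scale mul hull {x}" by (rule hull_inc) simp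
  have "x \<bullet> x \<in> subalgebra scale mul hull {x}"
    using x unfolding hull_def subalgebra_def by blast
  with x assms show ?thesis unfolding power_associative_def by blast
qed

end

section \<open>Expansion along lines through the idempotent\<close>

text \<open>The eigenvalues enter only as roots of \<open>2 X\<^sup>2 + X + 3\<close>, and the Peirce decomposition only as a
  decomposition of the kernel of the weight into a sum of eigenspaces.\<close>

locale baric_algebra_peirce = baric_algebra scale mul \<omega>
  for scale :: "'k::field \<Rightarrow> 'a::ab_group_add \<Rightarrow> 'a" (infixr "*s" 75)
    and mul :: "'a \<Rightarrow> 'a \<Rightarrow> 'a" (infixl "\<bullet>" 70) and \<omega> :: "'a \<Rightarrow> 'k" +
  fixes e :: 'a and lam lam_bar :: 'k
  assumes infinite_field: "infinite (UNIV :: 'k set)"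
    and two: "(2::'k) \<noteq> 0" and three: "(3::'k) \<noteq> 0"
    and idempotent: "e \<bullet> e = e" and weight_idempotent: "\<omega> e = 1"
    and roots: "2 * lam ^ 2 + lam + 3 = 0" "2 * lam_bar ^ 2 + lam_bar + 3 = 0"
    and sextic: "2 *s ((x \<bullet> x) \<bullet> (x \<bullet> (x \<bullet> (x \<bullet> x)))) =
      \<omega> x ^ 2 *s (x \<bullet> (x \<bullet> (x \<bullet> x))) + \<omega> x ^ 4 *s (x \<bullet> x)"
    and kernel_split: "\<omega> z = 0 \<Longrightarrow> \<exists>u \<in> peirce scale mul \<omega> e 0. \<exists>v \<in> peirce scale mul \<omega> e (1 / 2).
      \<exists>p \<in> peirce scale mul \<omega> e lam. \<exists>q \<in> peirce scale mul \<omega> e lam_bar. z = u + v + p + q"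
begin

abbreviation A where "A \<equiv> peirce scale mul \<omega> e"

lemma peirce_zero_iff: "u \<in> A 0 \<longleftrightarrow> \<omega> u = 0 \<and> e \<bullet> u = 0"
  by (simp add: peirce_def)

lemma double_eq_zero_iff: "(x::'a) + x = 0 \<longleftrightarrow> x = 0"
  using two by (simp flip: scale_two)

lemma triple_eq_zero_iff: "(x::'a) + x + x = 0 \<longleftrightarrow> x = 0"
proof -
  have "x + x + x = 3 *s x"
    using scale_left_distrib[of 2 1 x] by (simp add: scale_two)
  then show ?thesis using three by simp
qed

text \<open>Doubling instead of halving keeps the later computations free of fractions: they become identities
  in an abelian group.\<close>

lemma peirce_half_iff: "v \<in> A (1 / 2) \<longleftrightarrow> \<omega> v = 0 \<and> e \<bullet> v + e \<bullet> v = v"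
proof -
  have "e \<bullet> v = (1 / 2) *s v \<longleftrightarrow> 2 *s (e \<bullet> v) = 2 *s ((1 / 2) *s v)"
    using two by (simp del: scale_scale)
  also have "\<dots> \<longleftrightarrow> e \<bullet> v + e \<bullet> v = v" using two by (simp flip: scale_two)
  finally show ?thesis by (simp add: peirce_def)
qed

lemma peirce_uminus: "x \<in> A \<alpha> \<Longrightarrow> - x \<in> A \<alpha>"
  and peirce_add: "x \<in> A \<alpha> \<Longrightarrow> y \<in> A \<alpha> \<Longrightarrow> x + y \<in> A \<alpha>"
  and peirce_null: "0 \<in> A \<alpha>"
  by (simp_all add: peirce_def mul_distribs scale_right_distrib)

text \<open>The coefficients of \<open>x\<^sup>2\<close>, \<open>x\<^sup>3\<close> and \<open>x\<^sup>4\<close> on the line \<open>x = e + t y\<close>: \<open>a\<^sub>i\<close> belongs to \<open>x\<^sup>3\<close> and \<open>b\<^sub>i\<close>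
  to \<open>x\<^sup>4\<close>.\<close>

lemma line_coeffs:
  fixes y t
  defines "x \<equiv> e + t *s y"
  defines "c1 \<equiv> e \<bullet> y + e \<bullet> y" and "s \<equiv> y \<bullet> y"
  defines "a1 \<equiv> e \<bullet> c1 + e \<bullet> y" and "a2 \<equiv> e \<bullet> s + y \<bullet> c1" and "a3 \<equiv> y \<bullet> s"
  defines "b1 \<equiv> e \<bullet> a1 + e \<bullet> y" and "b2 \<equiv> e \<bullet> a2 + y \<bullet> a1" and "b3 \<equiv> e \<bullet> a3 + y \<bullet> a2"
    and "b4 \<equiv> y \<bullet> a3"
  shows line_power2: "x \<bullet> x = vec_poly t [e, c1, s]"
    and line_power3: "x \<bullet> (x \<bullet> x) = vec_poly t [e, a1, a2, a3]"
    and line_power4: "x \<bullet> (x \<bullet> (x \<bullet> x)) = vec_poly t [e, b1, b2, b3, b4]"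
proof -
  have x: "x = vec_poly t [e, y]" by (simp add: x_def)
  show p2: "x \<bullet> x = vec_poly t [e, c1, s]"
    unfolding x vec_poly_coeffs_mult[symmetric]
    by (simp add: c1_def s_def idempotent mult_commute[of y e] del: vec_poly_simps)
  show p3: "x \<bullet> (x \<bullet> x) = vec_poly t [e, a1, a2, a3]"
    unfolding p2 unfolding x vec_poly_coeffs_mult[symmetric]
    by (simp add: a1_def a2_def a3_def idempotent mult_commute[of y e] del: vec_poly_simps)
  show "x \<bullet> (x \<bullet> (x \<bullet> x)) = vec_poly t [e, b1, b2, b3, b4]"
    unfolding p3 unfolding x vec_poly_coeffs_mult[symmetric]
    by (simp add: b1_def b2_def b3_def b4_def idempotent mult_commute[of y e] del: vec_poly_simps)
qed

lemma weight_line: "\<omega> y = 0 \<Longrightarrow> \<omega> (e + t *s y) = 1"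
  by (simp add: weight_idempotent)

lemma sextic_coeffs:
  fixes y
  assumes "\<omega> y = 0"
  defines "c1 \<equiv> e \<bullet> y + e \<bullet> y" and "s \<equiv> y \<bullet> y"
  defines "a1 \<equiv> e \<bullet> c1 + e \<bullet> y" and "a2 \<equiv> e \<bullet> s + y \<bullet> c1" and "a3 \<equiv> y \<bullet> s"
  defines "b1 \<equiv> e \<bullet> a1 + e \<bullet> y" and "b2 \<equiv> e \<bullet> a2 + y \<bullet> a1" and "b3 \<equiv> e \<bullet> a3 + y \<bullet> a2"
  shows sextic_coeff2: "(e \<bullet> b2 + c1 \<bullet> b1 + e \<bullet> s) + (e \<bullet> b2 + c1 \<bullet> b1 + e \<bullet> s) = b2 + s"
    and sextic_coeff3: "(e \<bullet> b3 + c1 \<bullet> b2 + s \<bullet> b1) + (e \<bullet> b3 + c1 \<bullet> b2 + s \<bullet> b1) = b3"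
proof -
  define P where "P = coeffs_mult mul [e, c1, s] [e, b1, b2, b3, y \<bullet> a3]"
  have eq: "vec_poly t (coeffs_add P P) =
      vec_poly t (coeffs_add [e, b1, b2, b3, y \<bullet> a3] [e, c1, s])" for t
    using sextic[of "e + t *s y"] line_power2[where y=y and t=t] line_power4[where y=y and t=t]
    unfolding weight_line[OF assms(1)] P_def vec_poly_coeffs_add vec_poly_coeffs_mult scale_two
    by (simp only: c1_def s_def a1_def a2_def a3_def b1_def b2_def b3_def power_one scale_one)
  show "(e \<bullet> b2 + c1 \<bullet> b1 + e \<bullet> s) + (e \<bullet> b2 + c1 \<bullet> b1 + e \<bullet> s) = b2 + s"
    using vec_poly_eq_imp_nth_eq[OF infinite_field eq, of 2]
    by (simp add: P_def mult_commute[of s e] algebra_simps numeral_2_eq_2)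
  show "(e \<bullet> b3 + c1 \<bullet> b2 + s \<bullet> b1) + (e \<bullet> b3 + c1 \<bullet> b2 + s \<bullet> b1) = b3"
    using vec_poly_eq_imp_nth_eq[OF infinite_field eq, of 3]
    by (simp add: P_def algebra_simps numeral_3_eq_3)
qed

lemma quartic_coeffs:
  fixes y
  assumes quartic: "\<And>x. (x \<bullet> x) \<bullet> (x \<bullet> x) = x \<bullet> (x \<bullet> (x \<bullet> x))"
  defines "c1 \<equiv> e \<bullet> y + e \<bullet> y" and "s \<equiv> y \<bullet> y"
  defines "a1 \<equiv> e \<bullet> c1 + e \<bullet> y" and "a2 \<equiv> e \<bullet> s + y \<bullet> c1" and "a3 \<equiv> y \<bullet> s"
  shows quartic_coeff1: "e \<bullet> c1 + e \<bullet> c1 = e \<bullet> a1 + e \<bullet> y"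
    and quartic_coeff2: "e \<bullet> s + c1 \<bullet> c1 + e \<bullet> s = e \<bullet> a2 + y \<bullet> a1"
    and quartic_coeff3: "c1 \<bullet> s + c1 \<bullet> s = e \<bullet> a3 + y \<bullet> a2"
proof -
  have eq: "vec_poly t (coeffs_mult mul [e, c1, s] [e, c1, s]) =
      vec_poly t [e, e \<bullet> a1 + e \<bullet> y, e \<bullet> a2 + y \<bullet> a1, e \<bullet> a3 + y \<bullet> a2, y \<bullet> a3]" for t
    using quartic[of "e + t *s y"] line_power2[where y=y and t=t] line_power4[where y=y and t=t]
    unfolding vec_poly_coeffs_mult
    by (simp only: c1_def s_def a1_def a2_def a3_def)
  note coeff = vec_poly_eq_imp_nth_eq[OF infinite_field eq]
  show "e \<bullet> c1 + e \<bullet> c1 = e \<bullet> a1 + e \<bullet> y"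
    using coeff[of 1] by (simp add: mult_commute[of c1 e])
  show "e \<bullet> s + c1 \<bullet> c1 + e \<bullet> s = e \<bullet> a2 + y \<bullet> a1"
    using coeff[of 2] by (simp add: mult_commute[of s e] numeral_2_eq_2 algebra_simps)
  show "c1 \<bullet> s + c1 \<bullet> s = e \<bullet> a3 + y \<bullet> a2"
    using coeff[of 3] by (simp add: mult_commute[of s c1] numeral_3_eq_3)
qed

section \<open>Peirce components\<close>

lemma kernel_zero_half_split:
  assumes z: "\<omega> z = 0" and trivial: "A lam = {0}" "A lam_bar = {0}"
  obtains u v where "u \<in> A 0" "v \<in> A (1 / 2)" "z = u + v"
  using kernel_split[OF z] trivial by auto

text \<open>The coefficient of \<open>t\<close> in the quartic identity is \<open>\<mu> (2\<mu> - 1) (\<mu> - 1) y = 0\<close> for \<open>y\<close> in the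
  eigenspace of \<open>\<mu>\<close>. The values of \<open>2 X\<^sup>2 + X + 3\<close> at 0, 1/2 and 1 are 3, 4 and 6, all non-zero.\<close>

lemma quartic_imp_lambda_trivial:
  assumes quartic: "\<And>x. (x \<bullet> x) \<bullet> (x \<bullet> x) = x \<bullet> (x \<bullet> (x \<bullet> x))"
    and \<mu>: "2 * \<mu> ^ 2 + \<mu> + 3 = 0"
  shows "A \<mu> = {0}"
proof -
  have "y = 0" if "y \<in> A \<mu>" for y
  proof -
    have ey: "e \<bullet> y = \<mu> *s y" using that by (simp add: peirce_def)
    have "(2 * (2 * \<mu> * \<mu>)) *s y = (2 * \<mu> * \<mu> * \<mu> + \<mu> * \<mu> + \<mu>) *s y"
      using quartic_coeff1[OF quartic, of y]
      by (simp add: ey mul_distribs flip: scale_left_distrib) (simp add: algebra_simps)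
    then have "y = 0 \<or> 2 * (2 * \<mu> * \<mu>) = 2 * \<mu> * \<mu> * \<mu> + \<mu> * \<mu> + \<mu>" by auto
    moreover have False if q: "2 * (2 * \<mu> * \<mu>) = 2 * \<mu> * \<mu> * \<mu> + \<mu> * \<mu> + \<mu>"
    proof -
      have "\<mu> * ((2 * \<mu> - 1) * (\<mu> - 1)) = 0" using q by (simp add: algebra_simps)
      then consider "\<mu> = 0" | "2 * \<mu> = 1" | "\<mu> = 1" by auto
      then show False
      proof cases
        case 2
        have "2 * (2 * \<mu> ^ 2 + \<mu> + 3) = (2 * \<mu>) * (2 * \<mu>) + 2 * \<mu> + 6"
          by (simp add: algebra_simps power2_eq_square)
        then have "(2::'k) * (2 * 2) = 0" using \<mu> 2 by simp
        with two show False by (metis mult_eq_0_iff)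
      next
        case 3
        then have "(2::'k) * 3 = 0" using \<mu> by simp
        with two three show False by (metis mult_eq_0_iff)
      qed (use \<mu> three in simp)
    qed
    ultimately show "y = 0" by blast
  qed
  then show ?thesis using peirce_null by auto
qed

lemma zero_half_independent:
  assumes u: "u \<in> A 0" and v: "v \<in> A (1 / 2)" and eq: "u + v = 0"
  shows "u = 0" "v = 0"
proof -
  have "e \<bullet> v = 0"
    using arg_cong[OF eq, of "mul e"] u by (simp add: mul_distribs peirce_zero_iff)
  then show "v = 0" using v by (auto simp: peirce_half_iff)
  with eq show "u = 0" by simp
qed

context
  assumes trivial: "A lam = {0}" "A lam_bar = {0}"
begin

lemma half_powers:
  assumes "q \<in> A (1 / 2)"
  shows "e \<bullet> q + e \<bullet> q = q" "e \<bullet> (e \<bullet> q) + e \<bullet> (e \<bullet> q) = e \<bullet> q"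
    "e \<bullet> (e \<bullet> (e \<bullet> q)) + e \<bullet> (e \<bullet> (e \<bullet> q)) = e \<bullet> (e \<bullet> q)"
  using assms by (simp_all add: peirce_half_iff flip: mul_add_right)

text \<open>With \<open>L\<close> the multiplication by \<open>e\<close>, the coefficient of \<open>t\<^sup>2\<close> at \<open>y = v\<close> reads
  \<open>(2L\<^sup>3 + L\<^sup>2 + 3L) v\<^sup>2 = 0\<close>. The polynomial vanishes at 0 and takes the value 2 at 1/2, so \<open>v\<^sup>2\<close> has no
  component for 1/2.\<close>

lemma square_half:
  assumes v: "v \<in> A (1 / 2)"
  shows "v \<bullet> v \<in> A 0"
proof -
  have kv: "\<omega> v = 0" and ev: "e \<bullet> v + e \<bullet> v = v" using v by (simp_all add: peirce_half_iff)
  have "\<omega> (v \<bullet> v) = 0" using kv by simp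
  then obtain p q where p: "p \<in> A 0" and q: "q \<in> A (1 / 2)" and s: "v \<bullet> v = p + q"
    using kernel_zero_half_split trivial by metis
  have ep: "e \<bullet> p = 0" using p by (simp add: peirce_zero_iff)
  note hp = half_powers[OF q]
  have "(e \<bullet> (e \<bullet> (e \<bullet> q)) + e \<bullet> (e \<bullet> (e \<bullet> q))) + e \<bullet> (e \<bullet> q) + (e \<bullet> q + e \<bullet> q) + e \<bullet> q = 0"
    using sextic_coeff2[OF kv] unfolding ev s
    by (simp add: ep mul_distribs) (simp add: algebra_simps)
  then have "(e \<bullet> (e \<bullet> q) + e \<bullet> (e \<bullet> q)) + (e \<bullet> q + e \<bullet> q) + e \<bullet> q = 0"
    unfolding hp(3) .
  then have "q + q = 0" unfolding hp using hp(1) by (metis add.commute add.left_commute)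
  then have "q = 0" by (simp only: double_eq_zero_iff)
  with s p show ?thesis by simp
qed

text \<open>The part of the coefficient of \<open>t\<^sup>2\<close> at \<open>y = u + v\<close> that is bilinear in \<open>u\<close> and \<open>v\<close> reads
  \<open>(4L\<^sup>3 + 5L - 3) (u v) = 0\<close>. The polynomial vanishes at 1/2 and takes the value -3 at 0, so \<open>u v\<close> has
  no component in \<open>A\<^sub>0\<close>.\<close>

lemma mul_zero_half:
  assumes u: "u \<in> A 0" and v: "v \<in> A (1 / 2)" and sq0: "u \<bullet> u = 0"
  shows "u \<bullet> v \<in> A (1 / 2)"
proof -
  have kv: "\<omega> (u + v) = 0" and ev: "e \<bullet> v + e \<bullet> v = v"  and eu: "e \<bullet> u = 0"
    using u v by (simp_all add: peirce_half_iff peirce_zero_iff)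
  have evv: "e \<bullet> (v \<bullet> v) = 0" using square_half[OF v] by (simp add: peirce_zero_iff)
  have euv: "e \<bullet> (u + v) + e \<bullet> (u + v) = v" by (simp add: mul_distribs eu ev)
  have "\<omega> (u \<bullet> v) = 0" using u by (simp add: peirce_zero_iff)
  then obtain p q where p: "p \<in> A 0" and q: "q \<in> A (1 / 2)" and m: "u \<bullet> v = p + q"
    using kernel_zero_half_split trivial by metis
  have ep: "e \<bullet> p = 0" using p by (simp add: peirce_zero_iff)
  note hp = half_powers[OF q]
  have s: "(u + v) \<bullet> (u + v) = (p + p) + (q + q) + v \<bullet> v"
    by (simp add: mul_distribs sq0 m mult_commute[of v u] algebra_simps)
  have a1: "e \<bullet> v + e \<bullet> (u + v) = v" by (simp add: mul_distribs eu ev)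
  have yv: "(u + v) \<bullet> v = p + q + v \<bullet> v" by (simp add: mul_distribs m)
  have "((e \<bullet> (e \<bullet> (e \<bullet> q)) + e \<bullet> (e \<bullet> (e \<bullet> q))) + (e \<bullet> (e \<bullet> (e \<bullet> q)) + e \<bullet> (e \<bullet> (e \<bullet> q)))) +
      (e \<bullet> q + e \<bullet> q) + (e \<bullet> q + e \<bullet> q) + e \<bullet> q = (p + q) + (p + q) + (p + q)"
    using sextic_coeff2[OF kv] unfolding euv s a1 yv
    by (simp add: ep evv mul_distribs) (simp add: algebra_simps)
  then have "(e \<bullet> q + e \<bullet> q) + (e \<bullet> q + e \<bullet> q) + (e \<bullet> q + e \<bullet> q) = (p + q) + (p + q) + (p + q)"
    unfolding hp(3) unfolding hp(2) by (simp add: algebra_simps)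
  then have "p + p + p = 0" unfolding hp(1) by (simp add: algebra_simps)
  then have "p = 0" by (simp only: triple_eq_zero_iff)
  with m q show ?thesis by simp
qed

text \<open>At \<open>y = u\<close> the coefficient of \<open>t\<^sup>2\<close> in the quartic identity is \<open>2L u\<^sup>2 = L\<^sup>2 u\<^sup>2\<close>, which leaves only the
  component in \<open>A\<^sub>0\<close>; in the identity of degree 6 it is \<open>(2L\<^sup>3 - L\<^sup>2 + 2L - 1) u\<^sup>2 = 0\<close>, which is
  \<open>- u\<^sup>2 = 0\<close> on \<open>A\<^sub>0\<close>.\<close>

lemma quartic_imp_square_zero:
  assumes quartic: "\<And>x. (x \<bullet> x) \<bullet> (x \<bullet> x) = x \<bullet> (x \<bullet> (x \<bullet> x))" and u: "u \<in> A 0"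
  shows "u \<bullet> u = 0"
proof -
  have ku: "\<omega> u = 0" and eu: "e \<bullet> u = 0" using u by (simp_all add: peirce_zero_iff)
  have "\<omega> (u \<bullet> u) = 0" using ku by simp
  then obtain p q where p: "p \<in> A 0" and q: "q \<in> A (1 / 2)" and s: "u \<bullet> u = p + q"
    using kernel_zero_half_split trivial by metis
  have ep: "e \<bullet> p = 0" using p by (simp add: peirce_zero_iff)
  note hp = half_powers[OF q]
  have "e \<bullet> q + e \<bullet> q = e \<bullet> (e \<bullet> q)"
    using quartic_coeff2[OF quartic, of u] by (simp add: eu s ep mul_distribs)
  then have "q = e \<bullet> (e \<bullet> q)" by (simp add: hp(1))
  then have "(q + q) + (q + q) = q" using hp(1,2) by metis
  then have "q + q + q = 0" by (simp add: algebra_simps)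
  then have "q = 0" by (simp only: triple_eq_zero_iff)
  then show ?thesis using sextic_coeff2[OF ku] by (simp add: eu s ep)
qed

lemma cross_product_zero:
  assumes sq0: "\<And>u. u \<in> A 0 \<Longrightarrow> u \<bullet> u = 0" and u: "u \<in> A 0" and v: "v \<in> A 0"
  shows "u \<bullet> v = 0"
proof -
  have "u \<bullet> v + u \<bullet> v = 0"
    using sq0[OF peirce_add[OF u v]] by (simp add: mul_distribs sq0 u v mult_commute[of v u])
  then show ?thesis by (simp only: double_eq_zero_iff)
qed

context
  assumes sq0: "\<And>u. u \<in> A 0 \<Longrightarrow> u \<bullet> u = 0"
begin

text \<open>Because \<open>L\<close> halves \<open>u v\<close> and kills \<open>v\<^sup>2\<close>, the combination \<open>L y\<^sup>2 + y v\<close>, which is the coefficient of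
  \<open>t\<^sup>2\<close> in \<open>(e + t y)\<^sup>3\<close> for \<open>y = u + v\<close>, is again \<open>y\<^sup>2\<close>. Its multiplication by \<open>y\<close> loses the term
  \<open>u v\<^sup>2\<close>, a product inside \<open>A\<^sub>0\<close>.\<close>

lemma square_zero_plus_half:
  assumes u: "u \<in> A 0" and v: "v \<in> A (1 / 2)"
  shows "(u + v) \<bullet> (u + v) = u \<bullet> v + u \<bullet> v + v \<bullet> v"
    and "e \<bullet> ((u + v) \<bullet> (u + v)) + (u + v) \<bullet> v = (u + v) \<bullet> (u + v)"
    and "(u + v) \<bullet> ((u + v) \<bullet> (u + v)) = u \<bullet> (u \<bullet> v) + u \<bullet> (u \<bullet> v) + v \<bullet> ((u + v) \<bullet> (u + v))"
proof -
  show s: "(u + v) \<bullet> (u + v) = u \<bullet> v + u \<bullet> v + v \<bullet> v"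
    by (simp add: mul_distribs sq0[OF u] mult_commute[of v u] algebra_simps)
  have evv: "e \<bullet> (v \<bullet> v) = 0" using square_half[OF v] by (simp add: peirce_zero_iff)
  have em: "e \<bullet> (u \<bullet> v) + e \<bullet> (u \<bullet> v) = u \<bullet> v"
    using mul_zero_half[OF u v sq0[OF u]] by (simp add: peirce_half_iff)
  show "e \<bullet> ((u + v) \<bullet> (u + v)) + (u + v) \<bullet> v = (u + v) \<bullet> (u + v)"
    unfolding s unfolding mul_add_right mul_add_left evv em by (simp add: algebra_simps)
  have uvv: "u \<bullet> (v \<bullet> v) = 0" by (rule cross_product_zero[OF sq0 u square_half[OF v]])
  show "(u + v) \<bullet> ((u + v) \<bullet> (u + v)) = u \<bullet> (u \<bullet> v) + u \<bullet> (u \<bullet> v) + v \<bullet> ((u + v) \<bullet> (u + v))"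
  proof -
    have "u \<bullet> ((u + v) \<bullet> (u + v)) = u \<bullet> (u \<bullet> v) + u \<bullet> (u \<bullet> v)"
      unfolding s unfolding mul_add_right uvv by simp
    then show ?thesis by (simp only: mul_add_left[of u v "(u + v) \<bullet> (u + v)"])
  qed
qed

lemma line_zero_plus_half:
  assumes u: "u \<in> A 0" and v: "v \<in> A (1 / 2)"
  shows "e \<bullet> (u + v) + e \<bullet> (u + v) = v" "e \<bullet> v + e \<bullet> (u + v) = v" "\<omega> (u + v) = 0"
proof -
  have "e \<bullet> u = 0" "e \<bullet> v + e \<bullet> v = v" and k: "\<omega> u = 0" "\<omega> v = 0"
    using u v by (simp_all add: peirce_zero_iff peirce_half_iff)
  then show "e \<bullet> (u + v) + e \<bullet> (u + v) = v" "e \<bullet> v + e \<bullet> (u + v) = v"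
    by (simp_all only: mul_add_right add_0_left)
  show "\<omega> (u + v) = 0" by (simp add: k)
qed

text \<open>The coefficient of \<open>t\<^sup>3\<close> of the quartic identity at \<open>y = u + v\<close> mixes terms of several degrees in
  \<open>u\<close> and \<open>v\<close>. Comparing \<open>v\<close>, \<open>-v\<close> and \<open>u = 0\<close> isolates the part of degree \<open>(2, 1)\<close>, which is
  \<open>4 (L + 1) (u (u v)) = 0\<close>; since \<open>u (u v)\<close> lies in the eigenspace of 1/2, this is \<open>6 u (u v) = 0\<close>.\<close>

lemma quartic_imp_annihilation:
  assumes quartic: "\<And>x. (x \<bullet> x) \<bullet> (x \<bullet> x) = x \<bullet> (x \<bullet> (x \<bullet> x))"
    and u: "u \<in> A 0" and v: "v \<in> A (1 / 2)"
  shows "u \<bullet> (u \<bullet> v) = 0"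
proof -
  have gen: "v \<bullet> (u \<bullet> v + u \<bullet> v + v \<bullet> v) + v \<bullet> (u \<bullet> v + u \<bullet> v + v \<bullet> v) =
      e \<bullet> (u \<bullet> (u \<bullet> v) + u \<bullet> (u \<bullet> v) + v \<bullet> (u \<bullet> v + u \<bullet> v + v \<bullet> v)) +
      (u \<bullet> (u \<bullet> v) + u \<bullet> (u \<bullet> v) + v \<bullet> (u \<bullet> v + u \<bullet> v + v \<bullet> v))"
    if u: "u \<in> A 0" and v: "v \<in> A (1 / 2)" for u v
    using quartic_coeff3[OF quartic, of "u + v"]
    unfolding line_zero_plus_half[OF u v] square_zero_plus_half(2)[OF u v]
      square_zero_plus_half(3)[OF u v]
    unfolding square_zero_plus_half(1)[OF u v] .
  define n where "n = u \<bullet> (u \<bullet> v)"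
  define k where "k = v \<bullet> (u \<bullet> v)"
  define c where "c = v \<bullet> (v \<bullet> v)"
  have F1: "(k + k + c) + (k + k + c) = e \<bullet> (n + n + (k + k + c)) + (n + n + (k + k + c))"
    using gen[OF u v] by (simp only: n_def k_def c_def mul_add_right)
  have F2: "(k + k - c) + (k + k - c) = e \<bullet> (k + k - (n + n) - c) + (k + k - (n + n) - c)"
    using gen[OF u peirce_uminus[OF v]]
    by (simp add: n_def k_def c_def mul_distribs algebra_simps)
  have F3: "c + c = e \<bullet> c + c"
    using gen[OF peirce_null v] by (simp add: c_def)
  \<comment> \<open>the combination \<open>F1 - F2 - 2 F3\<close>, in which \<open>k\<close> and \<open>c\<close> cancel\<close>
  have "e \<bullet> (n + n + n + n) + (n + n + n + n) =
      (e \<bullet> (n + n + (k + k + c)) + (n + n + (k + k + c)) - ((k + k + c) + (k + k + c)))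
      - (e \<bullet> (k + k - (n + n) - c) + (k + k - (n + n) - c) - ((k + k - c) + (k + k - c)))
      + ((c + c) - (e \<bullet> c + c)) + ((c + c) - (e \<bullet> c + c))"
    by (simp add: mul_distribs algebra_simps)
  also have "\<dots> = 0" unfolding F1[symmetric] F2[symmetric] F3[symmetric] by simp
  finally have "(e \<bullet> n + e \<bullet> n) + (e \<bullet> n + e \<bullet> n) + (n + n + n + n) = 0"
    by (simp add: mul_distribs algebra_simps)
  moreover have "e \<bullet> n + e \<bullet> n = n"
    using mul_zero_half[OF u mul_zero_half[OF u v sq0[OF u]] sq0[OF u]]
    by (simp add: n_def peirce_half_iff)
  ultimately have "(n + n) + (n + n) + (n + n) = 0" by (simp add: algebra_simps)
  then show ?thesis by (simp only: triple_eq_zero_iff double_eq_zero_iff n_def)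
qed

text \<open>For \<open>w = y y\<^sup>2\<close> with \<open>y = u + v\<close>, the hypothesis on \<open>u (u v)\<close> gives \<open>w = v y\<^sup>2\<close> too, so that the
  coefficient of \<open>t\<^sup>3\<close> in the identity of degree 6 involves nothing but \<open>w\<close>: it is
  \<open>(2L\<^sup>2 + L + 3) w = 0\<close>, with the values 3 and 4 of the polynomial at 0 and 1/2.\<close>

lemma kernel_cube_zero:
  assumes u: "u \<in> A 0" and v: "v \<in> A (1 / 2)" and ann: "u \<bullet> (u \<bullet> v) = 0"
  shows "(u + v) \<bullet> ((u + v) \<bullet> (u + v)) = 0"
proof -
  define w where "w = (u + v) \<bullet> ((u + v) \<bullet> (u + v))"
  have vs: "v \<bullet> ((u + v) \<bullet> (u + v)) = w" "(u + v) \<bullet> (u + v) \<bullet> v = w"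
    using square_zero_plus_half(3)[OF u v]
    by (simp_all add: w_def ann mult_commute[of "(u + v) \<bullet> (u + v)" v])
  have "\<omega> w = 0" using line_zero_plus_half(3)[OF u v] by (simp add: w_def)
  then obtain p q where p: "p \<in> A 0" and q: "q \<in> A (1 / 2)" and w: "w = p + q"
    using kernel_zero_half_split trivial by metis
  have ep: "e \<bullet> p = 0" using p by (simp add: peirce_zero_iff)
  note hp = half_powers[OF q]
  have "e \<bullet> (e \<bullet> w + w) + w + w + (e \<bullet> (e \<bullet> w + w) + w + w) = e \<bullet> w + w"
    using sextic_coeff3[OF line_zero_plus_half(3)[OF u v]]
    unfolding line_zero_plus_half[OF u v] square_zero_plus_half(2)[OF u v] vs w_def[symmetric] .
  then have "(e \<bullet> (e \<bullet> q) + e \<bullet> (e \<bullet> q)) + e \<bullet> q + (q + q + q) + (p + p + p) = 0"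
    unfolding w by (simp add: mul_distribs ep algebra_simps)
  then have "(p + p + p) + ((q + q) + (q + q)) = 0"
    unfolding hp(2) hp(1) by (simp add: algebra_simps)
  moreover have "p + p + p \<in> A 0" "(q + q) + (q + q) \<in> A (1 / 2)"
    using p q by (simp_all add: peirce_add)
  ultimately have "p + p + p = 0" "(q + q) + (q + q) = 0"
    using zero_half_independent by blast+
  then have "p = 0" "q = 0" by (simp_all only: triple_eq_zero_iff double_eq_zero_iff)
  with w show ?thesis by (simp add: w_def)
qed

text \<open>With \<open>x = a e + y\<close>, \<open>y = u + v\<close> and \<open>a = \<omega>(x)\<close>, the powers are \<open>x\<^sup>2 = a\<^sup>2 e + a v + y\<^sup>2\<close> and
  \<open>x\<^sup>3 = a x\<^sup>2 + y y\<^sup>2\<close>.\<close>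

lemma annihilation_imp_cubic:
  assumes ann: "\<And>u v. u \<in> A 0 \<Longrightarrow> v \<in> A (1 / 2) \<Longrightarrow> u \<bullet> (u \<bullet> v) = 0"
  shows "x \<bullet> (x \<bullet> x) = \<omega> x *s (x \<bullet> x)"
proof -
  define a where "a = \<omega> x"
  have "\<omega> (x - a *s e) = 0" by (simp add: a_def weight_idempotent)
  then obtain u v where u: "u \<in> A 0" and v: "v \<in> A (1 / 2)" and "x - a *s e = u + v"
    using kernel_zero_half_split trivial by metis
  then have x: "x = a *s e + (u + v)" by (simp add: algebra_simps)
  define y where "y = u + v"
  have ey: "e \<bullet> y = e \<bullet> v" using u by (simp add: y_def mul_distribs peirce_zero_iff)
  have ev: "e \<bullet> v + e \<bullet> v = v" using v by (simp add: peirce_half_iff)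
  have s: "e \<bullet> (y \<bullet> y) + y \<bullet> v = y \<bullet> y"
    using square_zero_plus_half(2)[OF u v] by (simp add: y_def)
  have ys: "y \<bullet> (y \<bullet> y) = 0"
    using kernel_cube_zero[OF u v ann[OF u v]] by (simp add: y_def)
  have "x \<bullet> x = (a * a) *s e + a *s (e \<bullet> v + e \<bullet> v) + y \<bullet> y"
    unfolding x y_def[symmetric]
    by (simp add: mul_distribs idempotent mult_commute[of y e] ey scale_right_distrib algebra_simps)
  then have xx: "x \<bullet> x = (a * a) *s e + a *s v + y \<bullet> y" by (simp only: ev)
  have "x \<bullet> (x \<bullet> x) = (a * a * a) *s e + (a * a) *s (e \<bullet> v + e \<bullet> v) +
      a *s (e \<bullet> (y \<bullet> y) + y \<bullet> v) + y \<bullet> (y \<bullet> y)"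
    unfolding xx unfolding x y_def[symmetric]
    by (simp add: mul_distribs idempotent mult_commute[of y e] ey scale_right_distrib algebra_simps)
  also have "\<dots> = a *s (x \<bullet> x)"
    unfolding xx ev s ys by (simp add: scale_right_distrib algebra_simps)
  finally show ?thesis by (simp add: a_def)
qed

end

end

end

section \<open>The equivalences\<close>

theorem proposition4p2:
  fixes scale :: "'k::alg_closed_field \<Rightarrow> 'a::ab_group_add \<Rightarrow> 'a" (infixr "*s" 75)
    and mul :: "'a \<Rightarrow> 'a \<Rightarrow> 'a" (infixl "\<bullet>" 70)
    and \<omega> :: "'a \<Rightarrow> 'k"
    and e :: 'a
    and r lam lam_bar :: 'k
  defines "A \<equiv> peirce scale mul \<omega> e"
  assumes char: "CHAR('k) \<noteq> 2" "CHAR('k) \<noteq> 3"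
    and baric: "baric_algebra scale mul \<omega>"
    and identity: "\<And>x. 2 *s (ppow mul x 2 \<bullet> ppow mul x 4) =
      (\<omega> x ^ 2) *s ppow mul x 4 + (\<omega> x ^ 4) *s ppow mul x 2"
    and idempotent: "e \<noteq> 0" "e \<bullet> e = e"
    and root: "r ^ 2 = - 23"
    and lambda: "lam = (- 1 - r) / 4" "lam_bar = (- 1 + r) / 4"
    and decomposition:
      "direct_sum_decomposition [range (\<lambda>c. c *s e), A 0, A (1 / 2), A lam, A lam_bar]"
  defines "i \<equiv> jordan mul"
    and "ii \<equiv> power_associative scale mul"
    and "iii \<equiv> A lam = {0} \<and> A lam_bar = {0} \<and> (\<forall>x\<in>A 0. \<forall>y\<in>A 0. x \<bullet> y = 0) \<and>
      (\<forall>x\<in>A 0. \<forall>y\<in>A (1 / 2). x \<bullet> (x \<bullet> y) = 0)"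
    and "train \<equiv> principal_train_of_rank scale mul \<omega>"
    and "cubic \<equiv> (\<forall>x. ppow mul x 3 - \<omega> x *s ppow mul x 2 = 0)"
  shows "(i \<longleftrightarrow> ii) \<and> (ii \<longleftrightarrow> iii) \<and> (iii \<longleftrightarrow> (train 2 \<or> train 3) \<and> cubic) \<and>
    (\<not> train 2 \<longrightarrow> (iii \<longleftrightarrow> train 3 \<and> cubic))"
proof -
  interpret baric_algebra scale mul \<omega> by (rule baric)
  have pw: "ppow mul x 2 = x \<bullet> x" "ppow mul x 3 = x \<bullet> (x \<bullet> x)"
    "ppow mul x 4 = x \<bullet> (x \<bullet> (x \<bullet> x))" for x
    by (simp_all add: eval_nat_numeral)
  have char_dvd: "CHAR('k) dvd n \<Longrightarrow> prime n \<Longrightarrow> CHAR('k) = n" for n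
    by (metis CHAR_not_1 prime_nat_iff One_nat_def)
  have two: "(2::'k) \<noteq> 0" and three: "(3::'k) \<noteq> 0"
    using char char_dvd[of 2] char_dvd[of 3] of_nat_eq_0_iff_char_dvd[where 'a='k, of 2]
      of_nat_eq_0_iff_char_dvd[where 'a='k, of 3] by auto
  have split: "\<exists>c. \<exists>u\<in>A 0. \<exists>v\<in>A (1 / 2). \<exists>p\<in>A lam. \<exists>q\<in>A lam_bar.
      x = c *s e + (u + v + p + q)" for x
  proof -
    obtain xs where "xs \<in> listset [range (\<lambda>c. c *s e), A 0, A (1 / 2), A lam, A lam_bar]"
      and "x = sum_list xs"
      using decomposition unfolding direct_sum_decomposition_def by blast
    then show ?thesis by (auto simp: set_Cons_def add.assoc) blast
  qed
  have "\<omega> e \<noteq> 0"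
  proof
    assume "\<omega> e = 0"
    then have "\<omega> x = 0" for x using split[of x] by (auto simp: A_def peirce_def)
    then show False using weight_nonzero by simp
  qed
  then have weight_e: "\<omega> e = 1"
    using weight_mult[of e e] idempotent(2) by simp
  interpret P: baric_algebra_peirce scale mul \<omega> e lam lam_bar
  proof
    have four: "(4::'k) \<noteq> 0" using two by (metis mult_2 mult_eq_0_iff numeral_Bit0)
    \<comment> \<open>complete the square: \<open>8 (2\<mu>\<^sup>2 + \<mu> + 3) = (4\<mu> + 1)\<^sup>2 + 23\<close>\<close>
    have quadratic: "2 * \<mu> ^ 2 + \<mu> + 3 = 0" if "4 * \<mu> = - 1 + s" "s ^ 2 = - 23" for \<mu> s :: 'k
    proof -
      have "(2 * 4) * (2 * \<mu> ^ 2 + \<mu> + 3) = (4 * \<mu>) ^ 2 + 2 * (4 * \<mu>) + 24"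
        by (simp add: algebra_simps power2_eq_square)
      also have "\<dots> = s ^ 2 + 23" unfolding that(1) by (simp add: algebra_simps power2_eq_square)
      finally show ?thesis using that(2) two four by (metis add.left_inverse mult_eq_0_iff)
    qed
    show "2 * lam ^ 2 + lam + 3 = 0" "2 * lam_bar ^ 2 + lam_bar + 3 = 0"
      using quadratic[of lam "- r"] quadratic[of lam_bar r] root four
      by (simp_all add: lambda)
    show "\<exists>u\<in>peirce (*s) (\<bullet>) \<omega> e 0. \<exists>v\<in>peirce (*s) (\<bullet>) \<omega> e (1 / 2).
        \<exists>p\<in>peirce (*s) (\<bullet>) \<omega> e lam. \<exists>q\<in>peirce (*s) (\<bullet>) \<omega> e lam_bar. z = u + v + p + q"
      if "\<omega> z = 0" for z
    proof -
      obtain c u v p q where mem: "u\<in>A 0" "v\<in>A (1 / 2)" "p\<in>A lam" "q\<in>A lam_bar"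
        and z: "z = c *s e + (u + v + p + q)"
        using split by blast
      have "c = 0" using that mem unfolding z by (simp add: A_def peirce_def weight_e)
      then show ?thesis using mem z by (auto simp: A_def)
    qed
    show "2 *s (x \<bullet> x \<bullet> (x \<bullet> (x \<bullet> (x \<bullet> x)))) =
        \<omega> x ^ 2 *s (x \<bullet> (x \<bullet> (x \<bullet> x))) + \<omega> x ^ 4 *s (x \<bullet> x)" for x
      using identity[of x] by (simp only: pw)
  qed (use alg_closed_field_infinite two three idempotent weight_e in auto)
  have A: "A = P.A" by (simp add: A_def fun_eq_iff)
  have cubic_iff: "cubic \<longleftrightarrow> (\<forall>x. x \<bullet> (x \<bullet> x) = \<omega> x *s (x \<bullet> x))"
    by (simp add: cubic_def pw)
  have quartic_imp_iii: iii
    if quartic: "\<And>x. (x \<bullet> x) \<bullet> (x \<bullet> x) = x \<bullet> (x \<bullet> (x \<bullet> x))"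
  proof -
    have tr: "A lam = {0}" "A lam_bar = {0}"
      unfolding A by (rule P.quartic_imp_lambda_trivial[OF quartic] P.roots)+
    note sq0 = P.quartic_imp_square_zero[OF tr[unfolded A] quartic]
    show ?thesis
      unfolding iii_def using tr P.cross_product_zero[OF tr[unfolded A] sq0]
        P.quartic_imp_annihilation[OF tr[unfolded A] sq0 quartic]
      by (simp add: A)
  qed
  have i_imp: iii if i
  proof (rule quartic_imp_iii)
    fix x
    have "(x \<bullet> x) \<bullet> (x \<bullet> x) = ((x \<bullet> x) \<bullet> x) \<bullet> x"
      using that unfolding i_def jordan_def pw by blast
    then show "(x \<bullet> x) \<bullet> (x \<bullet> x) = x \<bullet> (x \<bullet> (x \<bullet> x))" by (metis mult_commute)
  qed
  have ii_imp: iii if ii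
    using that unfolding ii_def by (intro quartic_imp_iii power_associative_imp_quartic)
  have iii_imp: cubic if iii
    unfolding cubic_iff
  proof
    fix x
    have tr: "P.A lam = {0}" "P.A lam_bar = {0}"
      using that unfolding iii_def A by simp_all
    show "x \<bullet> (x \<bullet> x) = \<omega> x *s (x \<bullet> x)"
      by (rule P.annihilation_imp_cubic[OF tr]) (use that in \<open>simp_all add: iii_def A\<close>)
  qed
  have cubic_imp: i ii if cubic
  proof -
    have cubic': "x \<bullet> (x \<bullet> x) = \<omega> x *s (x \<bullet> x)" for x
      using that by (simp add: cubic_iff)
    show i unfolding i_def jordan_def pw using cubic_imp_jordan[OF two cubic'] by simp
    show ii unfolding ii_def by (rule cubic_imp_power_associative[OF two cubic'])
  qed
  have train: "train 2 \<or> train 3" if cubic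
  proof -
    define \<gamma> where "\<gamma> = (\<lambda>k::nat. if k = 1 then - 1 else 0 :: 'k)"
    have "{1..3 - 1} = {1, 2::nat}" by auto
    then have "train_equation scale mul \<omega> 3 \<gamma>"
      unfolding train_equation_def using that by (simp add: \<gamma>_def cubic_def)
    then have ex3: "\<exists>\<gamma>. train_equation scale mul \<omega> 3 \<gamma>" by blast
    show ?thesis
    proof (cases "\<exists>\<gamma>. train_equation scale mul \<omega> 2 \<gamma>")
      case True
      then have "train 2" unfolding train_def principal_train_of_rank_def by auto
      then show ?thesis ..
    next
      case False
      have "\<not> (\<exists>\<gamma>. train_equation scale mul \<omega> m \<gamma>)" if "2 \<le> m \<and> m < 3" for m
      proof -
        have "m = 2" using that by linarith
        with False show ?thesis by simp
      qed
      with ex3 have "train 3"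
        unfolding train_def principal_train_of_rank_def by simp
      then show ?thesis ..
    qed
  qed
  show ?thesis using i_imp ii_imp iii_imp cubic_imp train by blast
qed

end
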